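(* Let $G$ be a discrete group and $n\ge 1$ an integer. Then there exists a unique (topological) invariant mean on $VN^n(G)$.
   Context: $e$ is the identity of $G$. $VN(G)\subseteq\mathcal{B}(L^2(G))$ is the group von Neumann algebra, generated by the left regular representation $\lambda$, and $A(G)=VN(G)_*$ is the Fourier algebra. $A^n(G)$ is the set of functions $f$ on $G^n$ of the form $f(x_1,\dots,x_n)=\Phi(\lambda(x_1),\dots,\lambda(x_n))$, where $\Phi$ is a normal (separately weak*-continuous) completely bounded (i.e. multiplicatively bounded, in the Christensen–Sinclair sense) multilinear functional on $VN(G)\times\cdots\times VN(G)$ ($n$ factors), with norm $\|f\|_{A^n(G)}=\|\Phi\|_{cb}$. It is identified with the $n$-fold extended Haagerup tensor product $\otimes_n^{eh}A(G)$ and is a Banach algebra under pointwise multiplication. Its dual is $VN^n(G):=\otimes_n^{\sigma h}VN(G)$ (normal Haagerup tensor product); the elementary tensor $T_1\otimes\cdots\otimes T_n$ acts on $f$ by $\Phi(T_1,\dots,T_n)$. In particular $I\otimes\cdots\otimes I$ ($I$ the identity operator) is the functional $u\mapsto u(e,\dots,e)$. For $u\in A^n(G)$, $T\in VN^n(G)$, the element $uT\in VN^n(G)$ is defined by $\langle uT,v\rangle=\langle T,uv\rangle$ for $v\in A^n(G)$. A mean on $VN^n(G)$ is a functional $m\in VN^n(G)^*$ with $\|m\|=m(I\otimes\cdots\otimes I)=1$. A mean $m$ is a (topological) invariant mean if $m(uT)=u(e,\dots,e)\,m(T)$ for all $T\in VN^n(G)$, $u\in A^n(G)$. *)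

theory Defs
  imports "HOL-Analysis.Analysis" "HOL-Algebra.Group"
begin

text \<open>
  The discrete group \<open>G\<close> is a group in the sense of HOL-Algebra; its Haar measure is the counting
  measure on \<open>carrier G\<close>, so \<open>L\<^sup>2(G)\<close> is the space of square summable families.
  Convention: vectors, operators, elements of \<open>A\<^sup>n(G)\<close> and elements of \<open>VN\<^sup>n(G)\<close> occur as
  arguments of other maps and are therefore normalised to be zero outside their domain, so that
  equality in HOL is equality of the mathematical objects.  Multilinear functionals on \<open>VN(G)\<close> and
  functionals on \<open>VN\<^sup>n(G)\<close> are total functions of which only the restriction to the
  respective domain matters.  Elements of \<open>n\<close>-fold products are lists of length \<open>n\<close>.
\<close>

definition tuples :: "nat \<Rightarrow> 'b set \<Rightarrow> 'b list set" where
  "tuples n S = {xs. length xs = n \<and> set xs \<subseteq> S}"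

definition linear_functional_on :: "('b \<Rightarrow> complex) set \<Rightarrow> (('b \<Rightarrow> complex) \<Rightarrow> complex) \<Rightarrow> bool" where
  "linear_functional_on V \<phi> \<longleftrightarrow>
     (\<forall>u\<in>V. \<forall>v\<in>V. \<forall>a b. \<phi> (\<lambda>x. a * u x + b * v x) = a * \<phi> u + b * \<phi> v)"

definition bounded_functional_on ::
    "('b \<Rightarrow> complex) set \<Rightarrow> (('b \<Rightarrow> complex) \<Rightarrow> real) \<Rightarrow> (('b \<Rightarrow> complex) \<Rightarrow> complex) \<Rightarrow> bool" where
  "bounded_functional_on V N \<phi> \<longleftrightarrow>
     linear_functional_on V \<phi> \<and> (\<exists>C. \<forall>v\<in>V. cmod (\<phi> v) \<le> C * N v)"

definition functional_norm ::
    "('b \<Rightarrow> complex) set \<Rightarrow> (('b \<Rightarrow> complex) \<Rightarrow> real) \<Rightarrow> (('b \<Rightarrow> complex) \<Rightarrow> complex) \<Rightarrow> real" where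
  "functional_norm V N \<phi> = Sup {cmod (\<phi> v) | v. v \<in> V \<and> N v \<le> 1}"


subsection \<open>Operators on the Hilbert space of square summable families\<close>

definition l2 :: "'a set \<Rightarrow> ('a \<Rightarrow> complex) set" where
  "l2 X = {f. (\<lambda>x. (cmod (f x))\<^sup>2) summable_on X \<and> (\<forall>x. x \<notin> X \<longrightarrow> f x = 0)}"

definition l2_norm :: "'a set \<Rightarrow> ('a \<Rightarrow> complex) \<Rightarrow> real" where
  "l2_norm X f = sqrt (\<Sum>\<^sub>\<infinity>x\<in>X. (cmod (f x))\<^sup>2)"

definition l2_inner :: "'a set \<Rightarrow> ('a \<Rightarrow> complex) \<Rightarrow> ('a \<Rightarrow> complex) \<Rightarrow> complex" where
  "l2_inner X f g = (\<Sum>\<^sub>\<infinity>x\<in>X. f x * cnj (g x))"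

type_synonym 'a operator = "('a \<Rightarrow> complex) \<Rightarrow> ('a \<Rightarrow> complex)"

definition op_lincomb :: "complex \<Rightarrow> 'a operator \<Rightarrow> complex \<Rightarrow> 'a operator \<Rightarrow> 'a operator" where
  "op_lincomb a S b T = (\<lambda>f x. a * S f x + b * T f x)"

definition bounded_ops :: "'a set \<Rightarrow> 'a operator set" where
  "bounded_ops X = {T.
     (\<forall>f\<in>l2 X. T f \<in> l2 X) \<and>
     (\<forall>f\<in>l2 X. \<forall>g\<in>l2 X. \<forall>a b. T (\<lambda>x. a * f x + b * g x) = (\<lambda>x. a * T f x + b * T g x)) \<and>
     (\<exists>C. \<forall>f\<in>l2 X. l2_norm X (T f) \<le> C * l2_norm X f) \<and>
     (\<forall>f. f \<notin> l2 X \<longrightarrow> T f = (\<lambda>_. 0))}"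

definition commutant :: "'a set \<Rightarrow> 'a operator set \<Rightarrow> 'a operator set" where
  "commutant X S = {T \<in> bounded_ops X. \<forall>R\<in>S. T \<circ> R = R \<circ> T}"


subsection \<open>The group von Neumann algebra\<close>

definition left_regular :: "('a, 'm) monoid_scheme \<Rightarrow> 'a \<Rightarrow> 'a operator" where
  "left_regular G x = (\<lambda>f y. if f \<in> l2 (carrier G) \<and> y \<in> carrier G
                             then f (inv\<^bsub>G\<^esub> x \<otimes>\<^bsub>G\<^esub> y) else 0)"

text \<open>
  The range of the left regular representation is a self-adjoint set containing the identity,
  so the von Neumann algebra it generates is its double commutant.
\<close>

definition VN :: "('a, 'm) monoid_scheme \<Rightarrow> 'a operator set" where
  "VN G = commutant (carrier G) (commutant (carrier G) (left_regular G ` carrier G))"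

text \<open>
  The predual of a von Neumann algebra consists of the restrictions of the functionals
  \<open>T \<mapsto> \<Sum>\<^sub>i \<langle>T \<xi>\<^sub>i, \<eta>\<^sub>i\<rangle>\<close> with square summable sequences of vectors
  \<open>\<xi>\<close> and \<open>\<eta>\<close>; the weak* topology is the coarsest one making all of them continuous.
\<close>

definition predual_functionals :: "'a set \<Rightarrow> ('a operator \<Rightarrow> complex) set" where
  "predual_functionals X = {\<omega>. \<exists>\<xi> \<eta> :: nat \<Rightarrow> 'a \<Rightarrow> complex.
     (\<forall>i. \<xi> i \<in> l2 X \<and> \<eta> i \<in> l2 X) \<and>
     summable (\<lambda>i. (l2_norm X (\<xi> i))\<^sup>2) \<and> summable (\<lambda>i. (l2_norm X (\<eta> i))\<^sup>2) \<and>
     \<omega> = (\<lambda>T. \<Sum>i. l2_inner X (T (\<xi> i)) (\<eta> i))}"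

definition weak_star :: "('a, 'm) monoid_scheme \<Rightarrow> 'a operator topology" where
  "weak_star G = topology_generated_by
     {{T \<in> VN G. \<omega> T \<in> U} | \<omega> U. \<omega> \<in> predual_functionals (carrier G) \<and> open U}"


subsection \<open>Normal completely bounded multilinear functionals\<close>

definition multilinear_on_VN ::
    "nat \<Rightarrow> ('a, 'm) monoid_scheme \<Rightarrow> ('a operator list \<Rightarrow> complex) \<Rightarrow> bool" where
  "multilinear_on_VN n G \<Phi> \<longleftrightarrow>
     (\<forall>Ts \<in> tuples n (VN G). \<forall>i<n. \<forall>S\<in>VN G. \<forall>T\<in>VN G. \<forall>a b.
        \<Phi> (Ts[i := op_lincomb a S b T]) = a * \<Phi> (Ts[i := S]) + b * \<Phi> (Ts[i := T]))"

definition separately_normal ::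
    "nat \<Rightarrow> ('a, 'm) monoid_scheme \<Rightarrow> ('a operator list \<Rightarrow> complex) \<Rightarrow> bool" where
  "separately_normal n G \<Phi> \<longleftrightarrow>
     (\<forall>Ts \<in> tuples n (VN G). \<forall>i<n.
        continuous_map (weak_star G) euclidean (\<lambda>T. \<Phi> (Ts[i := T])))"

text \<open>
  Norm of a \<open>k \<times> k\<close> matrix of operators acting on the Hilbert space direct sum of \<open>k\<close> copies of
  \<open>l2 X\<close>, and of a \<open>k \<times> k\<close> complex matrix acting on \<open>\<complex>\<^sup>k\<close>.
\<close>

definition op_matrix_norm :: "'a set \<Rightarrow> nat \<Rightarrow> (nat \<Rightarrow> nat \<Rightarrow> 'a operator) \<Rightarrow> real" where
  "op_matrix_norm X k A =
     Sup {L2_set (\<lambda>i. l2_norm X (\<lambda>x. \<Sum>j<k. A i j (\<xi> j) x)) {..<k} | \<xi>.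
            (\<forall>j<k. \<xi> j \<in> l2 X) \<and> L2_set (\<lambda>j. l2_norm X (\<xi> j)) {..<k} \<le> 1}"

definition complex_matrix_norm :: "nat \<Rightarrow> (nat \<Rightarrow> nat \<Rightarrow> complex) \<Rightarrow> real" where
  "complex_matrix_norm k B =
     Sup {L2_set (\<lambda>i. cmod (\<Sum>j<k. B i j * z j)) {..<k} | z.
            L2_set (\<lambda>j. cmod (z j)) {..<k} \<le> 1}"

text \<open>
  Christensen--Sinclair amplification: the \<open>(i, j)\<close> entry of \<open>\<Phi>\<^sub>k(A\<^sub>0, \<dots>, A\<^sub>n\<^sub>-\<^sub>1)\<close> is the sum over
  all index paths \<open>i = p\<^sub>0, p\<^sub>1, \<dots>, p\<^sub>n = j\<close> of
  \<open>\<Phi> (A\<^sub>0(p\<^sub>0, p\<^sub>1), A\<^sub>1(p\<^sub>1, p\<^sub>2), \<dots>, A\<^sub>n\<^sub>-\<^sub>1(p\<^sub>n\<^sub>-\<^sub>1, p\<^sub>n))\<close>.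
\<close>

definition amplification ::
    "nat \<Rightarrow> ('a operator list \<Rightarrow> complex) \<Rightarrow> nat \<Rightarrow> (nat \<Rightarrow> nat \<Rightarrow> nat \<Rightarrow> 'a operator) \<Rightarrow>
     nat \<Rightarrow> nat \<Rightarrow> complex" where
  "amplification n \<Phi> k A i j =
     (\<Sum>p \<in> {p \<in> tuples (Suc n) {..<k}. p ! 0 = i \<and> p ! n = j}.
        \<Phi> (map (\<lambda>r. A r (p ! r) (p ! Suc r)) [0..<n]))"

definition amplification_norms ::
    "nat \<Rightarrow> ('a, 'm) monoid_scheme \<Rightarrow> ('a operator list \<Rightarrow> complex) \<Rightarrow> real set" where
  "amplification_norms n G \<Phi> =
     {complex_matrix_norm k (amplification n \<Phi> k A) | k A.
        1 \<le> k \<and> (\<forall>r<n. (\<forall>i<k. \<forall>j<k. A r i j \<in> VN G) \<and> op_matrix_norm (carrier G) k (A r) \<le> 1)}"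

definition completely_bounded ::
    "nat \<Rightarrow> ('a, 'm) monoid_scheme \<Rightarrow> ('a operator list \<Rightarrow> complex) \<Rightarrow> bool" where
  "completely_bounded n G \<Phi> \<longleftrightarrow> bdd_above (amplification_norms n G \<Phi>)"

definition cb_norm ::
    "nat \<Rightarrow> ('a, 'm) monoid_scheme \<Rightarrow> ('a operator list \<Rightarrow> complex) \<Rightarrow> real" where
  "cb_norm n G \<Phi> = Sup (amplification_norms n G \<Phi>)"

definition normal_cb_functionals ::
    "nat \<Rightarrow> ('a, 'm) monoid_scheme \<Rightarrow> ('a operator list \<Rightarrow> complex) set" where
  "normal_cb_functionals n G =
     {\<Phi>. multilinear_on_VN n G \<Phi> \<and> separately_normal n G \<Phi> \<and> completely_bounded n G \<Phi>}"


subsection \<open>The algebra \<open>A\<^sup>n(G)\<close> and its dual\<close>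

definition coefficient ::
    "nat \<Rightarrow> ('a, 'm) monoid_scheme \<Rightarrow> ('a operator list \<Rightarrow> complex) \<Rightarrow> 'a list \<Rightarrow> complex" where
  "coefficient n G \<Phi> = (\<lambda>xs. if xs \<in> tuples n (carrier G) then \<Phi> (map (left_regular G) xs) else 0)"

definition An :: "nat \<Rightarrow> ('a, 'm) monoid_scheme \<Rightarrow> ('a list \<Rightarrow> complex) set" where
  "An n G = coefficient n G ` normal_cb_functionals n G"

text \<open>
  On \<open>VN(G)\<close> the functional \<open>\<Phi>\<close> is determined by \<open>f\<close>, because the span of the left translations
  is weak* dense; hence the infimum below is taken over a single value.
\<close>

definition An_norm :: "nat \<Rightarrow> ('a, 'm) monoid_scheme \<Rightarrow> ('a list \<Rightarrow> complex) \<Rightarrow> real" where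
  "An_norm n G f = Inf {cb_norm n G \<Phi> | \<Phi>. \<Phi> \<in> normal_cb_functionals n G \<and> f = coefficient n G \<Phi>}"

definition VNn :: "nat \<Rightarrow> ('a, 'm) monoid_scheme \<Rightarrow> (('a list \<Rightarrow> complex) \<Rightarrow> complex) set" where
  "VNn n G = {T. bounded_functional_on (An n G) (An_norm n G) T \<and> (\<forall>u. u \<notin> An n G \<longrightarrow> T u = 0)}"

definition VNn_norm :: "nat \<Rightarrow> ('a, 'm) monoid_scheme \<Rightarrow> (('a list \<Rightarrow> complex) \<Rightarrow> complex) \<Rightarrow> real" where
  "VNn_norm n G = functional_norm (An n G) (An_norm n G)"

text \<open>
  The elementary tensor \<open>I \<otimes> \<dots> \<otimes> I\<close> sends the coefficient function of \<open>\<Phi>\<close> to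
  \<open>\<Phi> (I, \<dots>, I)\<close>, which is its value at \<open>(e, \<dots>, e)\<close> because \<open>I\<close> is the translation by \<open>e\<close>.
\<close>

definition unit_tensor :: "nat \<Rightarrow> ('a, 'm) monoid_scheme \<Rightarrow> ('a list \<Rightarrow> complex) \<Rightarrow> complex" where
  "unit_tensor n G = (\<lambda>u. if u \<in> An n G then u (replicate n \<one>\<^bsub>G\<^esub>) else 0)"

text \<open>
  The element \<open>uT\<close>, given by \<open>\<langle>uT, v\<rangle> = \<langle>T, uv\<rangle>\<close> for \<open>v\<close> in \<open>A\<^sup>n(G)\<close>.
\<close>

definition An_action ::
    "nat \<Rightarrow> ('a, 'm) monoid_scheme \<Rightarrow> ('a list \<Rightarrow> complex) \<Rightarrow>
     (('a list \<Rightarrow> complex) \<Rightarrow> complex) \<Rightarrow> (('a list \<Rightarrow> complex) \<Rightarrow> complex)" where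
  "An_action n G u T = (\<lambda>v. if v \<in> An n G then T (\<lambda>xs. u xs * v xs) else 0)"


subsection \<open>Invariant means\<close>

definition mean_on_VNn ::
    "nat \<Rightarrow> ('a, 'm) monoid_scheme \<Rightarrow> ((('a list \<Rightarrow> complex) \<Rightarrow> complex) \<Rightarrow> complex) \<Rightarrow> bool" where
  "mean_on_VNn n G m \<longleftrightarrow>
     bounded_functional_on (VNn n G) (VNn_norm n G) m \<and>
     functional_norm (VNn n G) (VNn_norm n G) m = 1 \<and>
     m (unit_tensor n G) = 1"

definition invariant_mean ::
    "nat \<Rightarrow> ('a, 'm) monoid_scheme \<Rightarrow> ((('a list \<Rightarrow> complex) \<Rightarrow> complex) \<Rightarrow> complex) \<Rightarrow> bool" where
  "invariant_mean n G m \<longleftrightarrow>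
     mean_on_VNn n G m \<and>
     (\<forall>T \<in> VNn n G. \<forall>u \<in> An n G.
        m (An_action n G u T) = u (replicate n \<one>\<^bsub>G\<^esub>) * m T)"

end

theory Submission
  imports Defs
begin

text \<open>
  Since \<open>G\<close> is discrete, the indicator function \<open>\<delta>\<close> of \<open>(e, \<dots>, e)\<close> is an element of norm at most
  one of \<open>A\<^sup>n(G)\<close>: it is the coefficient function of the product of \<open>n\<close> copies of the vector state
  \<open>T \<mapsto> \<langle>T \<delta>\<^sub>e, \<delta>\<^sub>e\<rangle>\<close>, whose amplifications are products of contractive matrices.  Because
  \<open>u \<delta> = u(e, \<dots>, e) \<delta>\<close>, evaluation at \<open>\<delta>\<close> is an invariant mean.  Conversely
  \<open>\<delta> T = \<langle>T, \<delta>\<rangle> (I \<otimes> \<dots> \<otimes> I)\<close>, so every invariant mean \<open>m\<close> satisfies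
  \<open>m(T) = m(\<delta> T) = \<langle>T, \<delta>\<rangle>\<close>.
\<close>

lemma linear_functional_onD:
  assumes "linear_functional_on V \<phi>" "u \<in> V" "v \<in> V"
  shows "\<phi> (\<lambda>x. a * u x + b * v x) = a * \<phi> u + b * \<phi> v"
  using assms by (simp add: linear_functional_on_def)


subsection \<open>Square summable families\<close>

lemma l2_norm_nonneg: "0 \<le> l2_norm X f"
  by (simp add: l2_norm_def infsum_nonneg)

lemma l2_norm_power2: "(l2_norm X f)\<^sup>2 = (\<Sum>\<^sub>\<infinity>x\<in>X. (cmod (f x))\<^sup>2)"
  by (simp add: l2_norm_def infsum_nonneg)

lemma l2_zero: "(\<lambda>_. 0) \<in> l2 X"
  by (simp add: l2_def)

lemma l2_norm_zero: "l2_norm X (\<lambda>_. 0) = 0"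
  by (simp add: l2_norm_def)

lemma cmod_le_l2_norm:
  assumes "f \<in> l2 X" "e \<in> X"
  shows "cmod (f e) \<le> l2_norm X f"
proof -
  have "(\<Sum>x\<in>{e}. (cmod (f x))\<^sup>2) \<le> (\<Sum>\<^sub>\<infinity>x\<in>X. (cmod (f x))\<^sup>2)"
    using assms by (intro finite_sum_le_infsum) (auto simp: l2_def)
  then show ?thesis
    by (intro power2_le_imp_le[OF _ l2_norm_nonneg]) (simp add: l2_norm_power2)
qed

definition point_mass :: "'a \<Rightarrow> 'a \<Rightarrow> complex" where
  "point_mass e = (\<lambda>x. if x = e then 1 else 0)"

lemma scaled_point_mass:
  assumes "e \<in> X"
  shows "(\<lambda>x. z * point_mass e x) \<in> l2 X"
    and "l2_norm X (\<lambda>x. z * point_mass e x) = cmod z"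
proof -
  have eq: "(cmod (z * point_mass e x))\<^sup>2 = (if x = e then (cmod z)\<^sup>2 else 0)" for x
    by (simp add: point_mass_def)
  have "((\<lambda>x. if x = e then (cmod z)\<^sup>2 else 0) has_sum (cmod z)\<^sup>2) X"
    using has_sum_finite_neutralI[of "{e}" X "\<lambda>x. if x = e then (cmod z)\<^sup>2 else 0"] assms by simp
  then have sum: "((\<lambda>x. (cmod (z * point_mass e x))\<^sup>2) has_sum (cmod z)\<^sup>2) X"
    unfolding eq .
  then show "(\<lambda>x. z * point_mass e x) \<in> l2 X"
    using assms unfolding l2_def by (auto intro: has_sum_imp_summable simp: point_mass_def)
  show "l2_norm X (\<lambda>x. z * point_mass e x) = cmod z"
    unfolding l2_norm_def using infsumI[OF sum] by simp
qed

lemma point_mass_in_l2: "e \<in> X \<Longrightarrow> point_mass e \<in> l2 X"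
  using scaled_point_mass(1)[of e X 1] by simp

lemma l2_inner_point_mass:
  assumes "e \<in> X"
  shows "l2_inner X f (point_mass e) = f e"
  unfolding l2_inner_def
  using assms by (intro infsumI has_sum_finite_neutralI[of "{e}"]) (auto simp: point_mass_def)

lemma has_sum_sum:
  fixes f :: "'j \<Rightarrow> 'x \<Rightarrow> 'b :: topological_comm_monoid_add"
  assumes "\<And>j. j \<in> J \<Longrightarrow> (f j has_sum s j) X"
  shows "((\<lambda>x. \<Sum>j\<in>J. f j x) has_sum (\<Sum>j\<in>J. s j)) X"
  using assms by (induction J rule: infinite_finite_induct) (auto intro: has_sum_add)

text \<open>Pointwise Cauchy-Schwarz over the \<open>k\<close> summands, then summation over
  \<open>X\<close>. The crude factor \<open>k\<close> is harmless: the bound only serves to show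
  that certain suprema are finite, and the first part only to obtain membership.\<close>

lemma l2_sum:
  assumes "\<And>j. j < k \<Longrightarrow> f j \<in> l2 X"
  shows "(\<lambda>x. \<Sum>j<k. f j x) \<in> l2 X"
    and "(l2_norm X (\<lambda>x. \<Sum>j<k. f j x))\<^sup>2 \<le> real k * (\<Sum>j<k. (l2_norm X (f j))\<^sup>2)"
proof -
  have point: "(cmod (\<Sum>j<k. f j x))\<^sup>2 \<le> real k * (\<Sum>j<k. (cmod (f j x))\<^sup>2)" for x
  proof -
    have "(cmod (\<Sum>j<k. f j x))\<^sup>2 \<le> (\<Sum>j<k. cmod (f j x))\<^sup>2"
      by (intro power_mono norm_sum) auto
    also have "\<dots> \<le> real k * (\<Sum>j<k. (cmod (f j x))\<^sup>2)"
      using sum_squared_le_sum_of_squares[of "\<lambda>j. cmod (f j x)" "{..<k}"] by (simp add: mult.commute)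
    finally show ?thesis .
  qed
  have "((\<lambda>x. (cmod (f j x))\<^sup>2) has_sum (l2_norm X (f j))\<^sup>2) X" if "j < k" for j
    using assms[OF that] by (simp add: l2_def l2_norm_power2)
  then have sum: "((\<lambda>x. real k * (\<Sum>j<k. (cmod (f j x))\<^sup>2))
      has_sum (real k * (\<Sum>j<k. (l2_norm X (f j))\<^sup>2))) X"
    by (intro has_sum_cmult_right has_sum_sum) auto
  then have dom: "(\<lambda>x. real k * (\<Sum>j<k. (cmod (f j x))\<^sup>2)) summable_on X"
    by (rule has_sum_imp_summable)
  have summable: "(\<lambda>x. (cmod (\<Sum>j<k. f j x))\<^sup>2) summable_on X"
    using summable_on_comparison_test[OF dom] point by auto
  then show "(\<lambda>x. \<Sum>j<k. f j x) \<in> l2 X"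
    using assms by (auto simp: l2_def)
  have "(l2_norm X (\<lambda>x. \<Sum>j<k. f j x))\<^sup>2 \<le> (\<Sum>\<^sub>\<infinity>x\<in>X. real k * (\<Sum>j<k. (cmod (f j x))\<^sup>2))"
    unfolding l2_norm_power2 by (intro infsum_mono summable dom point)
  also have "\<dots> = real k * (\<Sum>j<k. (l2_norm X (f j))\<^sup>2)"
    using sum by (rule infsumI)
  finally show "(l2_norm X (\<lambda>x. \<Sum>j<k. f j x))\<^sup>2 \<le> real k * (\<Sum>j<k. (l2_norm X (f j))\<^sup>2)" .
qed


subsection \<open>Matrix norms\<close>

text \<open>A real \<open>Sup\<close> dominates its members only when the set is bounded above. Here
  a bound comes from the operator bounds \<open>C i j\<close> of the finitely many entries, through
  \<open>l2_sum\<close>.\<close>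

lemma op_matrix_norm_upper:
  assumes A: "\<And>i j. i < k \<Longrightarrow> j < k \<Longrightarrow> A i j \<in> bounded_ops X"
    and \<xi>: "\<And>j. j < k \<Longrightarrow> \<xi> j \<in> l2 X" "L2_set (\<lambda>j. l2_norm X (\<xi> j)) {..<k} \<le> 1"
  shows "L2_set (\<lambda>i. l2_norm X (\<lambda>x. \<Sum>j<k. A i j (\<xi> j) x)) {..<k} \<le> op_matrix_norm X k A"
proof -
  have "\<forall>i j. \<exists>C. i < k \<longrightarrow> j < k \<longrightarrow> (\<forall>f\<in>l2 X. l2_norm X (A i j f) \<le> C * l2_norm X f)"
    using A unfolding bounded_ops_def by blast
  then obtain C where
    C: "\<And>i j f. i < k \<Longrightarrow> j < k \<Longrightarrow> f \<in> l2 X \<Longrightarrow> l2_norm X (A i j f) \<le> C i j * l2_norm X f"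
    by metis
  have bound: "L2_set (\<lambda>i. l2_norm X (\<lambda>x. \<Sum>j<k. A i j (\<zeta> j) x)) {..<k}
      \<le> (\<Sum>i<k. sqrt (real k * (\<Sum>j<k. (C i j)\<^sup>2)))"
    if \<zeta>: "\<forall>j<k. \<zeta> j \<in> l2 X" "L2_set (\<lambda>j. l2_norm X (\<zeta> j)) {..<k} \<le> 1" for \<zeta>
  proof -
    have one: "l2_norm X (\<zeta> j) \<le> 1" if "j < k" for j
      using member_le_L2_set[of "{..<k}" j "\<lambda>j. l2_norm X (\<zeta> j)"] that \<zeta>(2) by simp
    have "l2_norm X (\<lambda>x. \<Sum>j<k. A i j (\<zeta> j) x) \<le> sqrt (real k * (\<Sum>j<k. (C i j)\<^sup>2))"
      if i: "i < k" for i
    proof -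
      have sq: "(l2_norm X (A i j (\<zeta> j)))\<^sup>2 \<le> (C i j)\<^sup>2" if j: "j < k" for j
      proof -
        have "l2_norm X (A i j (\<zeta> j)) \<le> C i j * l2_norm X (\<zeta> j)"
          using C i j \<zeta>(1) by blast
        \<comment> \<open>The constants supplied by \<open>bounded_ops\<close> carry no sign
          condition, hence the absolute value.\<close>
        also have "\<dots> \<le> \<bar>C i j\<bar> * 1"
          using one[OF j] by (intro mult_mono) (auto simp: l2_norm_nonneg)
        finally show ?thesis
          using power_mono[OF _ l2_norm_nonneg, of X "A i j (\<zeta> j)" "\<bar>C i j\<bar>" 2] by simp
      qed
      have "A i j (\<zeta> j) \<in> l2 X" if "j < k" for j
        using A[OF i that] \<zeta>(1) that by (auto simp: bounded_ops_def)
      then have "(l2_norm X (\<lambda>x. \<Sum>j<k. A i j (\<zeta> j) x))\<^sup>2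
          \<le> real k * (\<Sum>j<k. (l2_norm X (A i j (\<zeta> j)))\<^sup>2)"
        by (rule l2_sum(2))
      also have "\<dots> \<le> real k * (\<Sum>j<k. (C i j)\<^sup>2)"
        using sq by (intro mult_left_mono sum_mono) auto
      finally show ?thesis
        by (rule real_le_rsqrt)
    qed
    then show ?thesis
      by (intro order_trans[OF L2_set_le_sum] sum_mono) (auto simp: l2_norm_nonneg)
  qed
  show ?thesis
    unfolding op_matrix_norm_def
  proof (rule cSup_upper[OF _ bdd_aboveI[where M = "\<Sum>i<k. sqrt (real k * (\<Sum>j<k. (C i j)\<^sup>2))"]])
    show "L2_set (\<lambda>i. l2_norm X (\<lambda>x. \<Sum>j<k. A i j (\<xi> j) x)) {..<k}
      \<in> {L2_set (\<lambda>i. l2_norm X (\<lambda>x. \<Sum>j<k. A i j (\<zeta> j) x)) {..<k} | \<zeta>.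
            (\<forall>j<k. \<zeta> j \<in> l2 X) \<and> L2_set (\<lambda>j. l2_norm X (\<zeta> j)) {..<k} \<le> 1}"
      using \<xi> by (intro CollectI exI[of _ \<xi>]) simp
  qed (elim CollectE exE conjE, simp only: bound)
qed

text \<open>As for operator matrices, the point is that the supremum is finite; the sum of the
  moduli of all entries bounds it.\<close>

lemma complex_matrix_norm_upper:
  assumes "L2_set (\<lambda>j. cmod (z j)) {..<k} \<le> 1"
  shows "L2_set (\<lambda>i. cmod (\<Sum>j<k. B i j * z j)) {..<k} \<le> complex_matrix_norm k B"
proof -
  have bound: "L2_set (\<lambda>i. cmod (\<Sum>j<k. B i j * w j)) {..<k} \<le> (\<Sum>i<k. \<Sum>j<k. cmod (B i j))"
    if w: "L2_set (\<lambda>j. cmod (w j)) {..<k} \<le> 1" for w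
  proof -
    have one: "cmod (w j) \<le> 1" if "j < k" for j
      using member_le_L2_set[of "{..<k}" j "\<lambda>j. cmod (w j)"] that w by simp
    have "cmod (\<Sum>j<k. B i j * w j) \<le> (\<Sum>j<k. cmod (B i j))" for i
      using one by (intro sum_norm_le) (auto simp: norm_mult intro: mult_left_le)
    then show ?thesis
      by (intro order_trans[OF L2_set_le_sum] sum_mono) auto
  qed
  show ?thesis
    unfolding complex_matrix_norm_def
  proof (rule cSup_upper[OF _ bdd_aboveI[where M = "\<Sum>i<k. \<Sum>j<k. cmod (B i j)"]])
    show "L2_set (\<lambda>i. cmod (\<Sum>j<k. B i j * z j)) {..<k}
      \<in> {L2_set (\<lambda>i. cmod (\<Sum>j<k. B i j * w j)) {..<k} | w. L2_set (\<lambda>j. cmod (w j)) {..<k} \<le> 1}"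
      using assms by (intro CollectI exI[of _ z]) simp
  qed (elim CollectE exE conjE, simp only: bound)
qed

lemma complex_matrix_norm_least:
  assumes "\<And>z. L2_set (\<lambda>j. cmod (z j)) {..<k} \<le> 1 \<Longrightarrow>
    L2_set (\<lambda>i. cmod (\<Sum>j<k. B i j * z j)) {..<k} \<le> c"
  shows "complex_matrix_norm k B \<le> c"
proof -
  \<comment> \<open>The zero vector makes the set nonempty, which a least upper bound argument for a
    real \<open>Sup\<close> requires.\<close>
  have "L2_set (\<lambda>j. cmod (0 :: complex)) {..<k} \<le> 1"
    by (simp add: L2_set_def)
  then show ?thesis
    unfolding complex_matrix_norm_def
    by (intro cSup_least) (fast, elim CollectE exE conjE, simp only: assms)
qed

lemma complex_matrix_norm_lincomb:
  "complex_matrix_norm k (\<lambda>i j. a * B i j + b * C i j)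
    \<le> cmod a * complex_matrix_norm k B + cmod b * complex_matrix_norm k C"
proof (rule complex_matrix_norm_least)
  fix z :: "nat \<Rightarrow> complex"
  assume z: "L2_set (\<lambda>j. cmod (z j)) {..<k} \<le> 1"
  have "L2_set (\<lambda>i. cmod (\<Sum>j<k. (a * B i j + b * C i j) * z j)) {..<k}
      = L2_set (\<lambda>i. cmod (a * (\<Sum>j<k. B i j * z j) + b * (\<Sum>j<k. C i j * z j))) {..<k}"
    by (simp add: distrib_right sum.distrib sum_distrib_left mult.assoc)
  also have "\<dots> \<le> L2_set (\<lambda>i. cmod a * cmod (\<Sum>j<k. B i j * z j)
      + cmod b * cmod (\<Sum>j<k. C i j * z j)) {..<k}"
    by (intro L2_set_mono) (auto simp flip: norm_mult intro: norm_triangle_ineq)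
  also have "\<dots> \<le> cmod a * L2_set (\<lambda>i. cmod (\<Sum>j<k. B i j * z j)) {..<k}
      + cmod b * L2_set (\<lambda>i. cmod (\<Sum>j<k. C i j * z j)) {..<k}"
    by (simp add: L2_set_right_distrib L2_set_triangle_ineq)
  also have "\<dots> \<le> cmod a * complex_matrix_norm k B + cmod b * complex_matrix_norm k C"
    using z by (intro add_mono mult_left_mono complex_matrix_norm_upper) auto
  finally show "L2_set (\<lambda>i. cmod (\<Sum>j<k. (a * B i j + b * C i j) * z j)) {..<k}
      \<le> cmod a * complex_matrix_norm k B + cmod b * complex_matrix_norm k C" .
qed


subsection \<open>Products of contractive matrices as sums over paths\<close>

lemma finite_tuples: "finite S \<Longrightarrow> finite (tuples n S)"
  using finite_lists_length_eq[of S n] by (simp add: tuples_def conj_commute)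

lemma tuples_nth: "p \<in> tuples n S \<Longrightarrow> i < n \<Longrightarrow> p ! i \<in> S"
  using subsetD[OF _ nth_mem, of p S i] by (simp add: tuples_def)

text \<open>Removing the initial vertex \<open>i\<close> leaves an arbitrary path of length one
  less; grouping these by their first vertex \<open>j\<close> factors out \<open>M 0 i j\<close>.
  This is the recursion of the matrix-vector product, so the path sum is the \<open>i\<close>-th
  entry of the product of the matrices applied to \<open>z\<close>.\<close>

lemma sum_paths_Suc:
  fixes M :: "nat \<Rightarrow> nat \<Rightarrow> nat \<Rightarrow> complex"
  assumes "i < k"
  shows "(\<Sum>p\<in>{p \<in> tuples (Suc (Suc n)) {..<k}. p ! 0 = i}.
            (\<Prod>r<Suc n. M r (p ! r) (p ! Suc r)) * z (p ! Suc n))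
       = (\<Sum>j<k. M 0 i j * (\<Sum>p\<in>{p \<in> tuples (Suc n) {..<k}. p ! 0 = j}.
            (\<Prod>r<n. M (Suc r) (p ! r) (p ! Suc r)) * z (p ! n)))"
proof -
  define Q where "Q = tuples (Suc n) {..<k}"
  have finQ: "finite Q"
    unfolding Q_def by (intro finite_tuples) simp
  have hd: "p ! 0 < k" if "p \<in> Q" for p
    using tuples_nth[of p "Suc n" "{..<k}" 0] that by (simp add: Q_def)
  have paths: "{p \<in> tuples (Suc (Suc n)) {..<k}. p ! 0 = i} = Cons i ` Q"
    using assms by (auto simp: Q_def tuples_def image_iff length_Suc_conv)
  have "(\<Sum>p\<in>{p \<in> tuples (Suc (Suc n)) {..<k}. p ! 0 = i}.
            (\<Prod>r<Suc n. M r (p ! r) (p ! Suc r)) * z (p ! Suc n))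
      = (\<Sum>p\<in>Q. M 0 i (p ! 0) * ((\<Prod>r<n. M (Suc r) (p ! r) (p ! Suc r)) * z (p ! n)))"
    unfolding paths
    by (subst sum.reindex) (auto simp: prod.lessThan_Suc_shift mult.assoc simp del: prod.lessThan_Suc)
  also have "\<dots> = (\<Sum>j<k. \<Sum>p\<in>{p \<in> Q. p ! 0 = j}.
      M 0 i (p ! 0) * ((\<Prod>r<n. M (Suc r) (p ! r) (p ! Suc r)) * z (p ! n)))"
    using hd by (intro sum.group[symmetric] finQ) auto
  also have "\<dots> = (\<Sum>j<k. M 0 i j * (\<Sum>p\<in>{p \<in> Q. p ! 0 = j}.
            (\<Prod>r<n. M (Suc r) (p ! r) (p ! Suc r)) * z (p ! n)))"
    unfolding sum_distrib_left by (intro sum.cong refl) auto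
  finally show ?thesis
    unfolding Q_def .
qed

text \<open>The vector of path sums is a product of matrices applied to \<open>z\<close>, and each
  factor maps the unit ball into itself. The family \<open>M\<close> varies in the induction because
  peeling off the first matrix shifts the remaining ones.\<close>

lemma L2_set_paths_le:
  fixes M :: "nat \<Rightarrow> nat \<Rightarrow> nat \<Rightarrow> complex"
  assumes "\<And>r w. r < n \<Longrightarrow> L2_set (\<lambda>j. cmod (w j)) {..<k} \<le> 1 \<Longrightarrow>
      L2_set (\<lambda>i. cmod (\<Sum>j<k. M r i j * w j)) {..<k} \<le> 1"
    and "L2_set (\<lambda>j. cmod (z j)) {..<k} \<le> 1"
  shows "L2_set (\<lambda>i. cmod (\<Sum>p\<in>{p \<in> tuples (Suc n) {..<k}. p ! 0 = i}.
      (\<Prod>r<n. M r (p ! r) (p ! Suc r)) * z (p ! n))) {..<k} \<le> 1"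
  using assms
proof (induction n arbitrary: M)
  case 0
  \<comment> \<open>Without matrices a path is a single vertex, so the vector is \<open>z\<close>
    itself.\<close>
  have "{p \<in> tuples (Suc 0) {..<k}. p ! 0 = i} = {[i]}" if "i < k" for i
    using that by (auto simp: tuples_def length_Suc_conv)
  then have "L2_set (\<lambda>i. cmod (\<Sum>p\<in>{p \<in> tuples (Suc 0) {..<k}. p ! 0 = i}. z (p ! 0))) {..<k}
      = L2_set (\<lambda>j. cmod (z j)) {..<k}"
    by (intro L2_set_cong) auto
  then show ?case
    using 0 by simp
next
  case (Suc n)
  have "L2_set (\<lambda>i. cmod (\<Sum>j<k. M 0 i j * (\<Sum>p\<in>{p \<in> tuples (Suc n) {..<k}. p ! 0 = j}.
            (\<Prod>r<n. M (Suc r) (p ! r) (p ! Suc r)) * z (p ! n)))) {..<k} \<le> 1"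
    by (intro Suc.prems(1) Suc.IH[where M = "\<lambda>r. M (Suc r)"] Suc.prems(2)) auto
  also have "L2_set (\<lambda>i. cmod (\<Sum>j<k. M 0 i j * (\<Sum>p\<in>{p \<in> tuples (Suc n) {..<k}. p ! 0 = j}.
            (\<Prod>r<n. M (Suc r) (p ! r) (p ! Suc r)) * z (p ! n)))) {..<k}
    = L2_set (\<lambda>i. cmod (\<Sum>p\<in>{p \<in> tuples (Suc (Suc n)) {..<k}. p ! 0 = i}.
            (\<Prod>r<Suc n. M r (p ! r) (p ! Suc r)) * z (p ! Suc n))) {..<k}"
    by (intro L2_set_cong refl arg_cong[where f = cmod] sum_paths_Suc[symmetric]) auto
  finally show ?case .
qed


subsection \<open>The group von Neumann algebra\<close>

lemma VN_subset_bounded_ops: "VN G \<subseteq> bounded_ops (carrier G)"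
  by (auto simp: VN_def commutant_def)

text \<open>The space is the union of the subbasic sets, all of which lie in \<open>VN G\<close>;
  the zero functional together with the open set \<open>UNIV\<close> yields \<open>VN G\<close>
  itself.\<close>

lemma topspace_weak_star: "topspace (weak_star G) = VN G"
proof -
  have "(\<lambda>T. \<Sum>i. l2_inner (carrier G) (T (\<lambda>_. 0)) (\<lambda>_. 0)) \<in> predual_functionals (carrier G)"
    unfolding predual_functionals_def
    by (intro CollectI exI[of _ "\<lambda>_ _. 0"] conjI refl) (auto simp: l2_zero l2_norm_zero)
  then have "VN G \<in> {{T \<in> VN G. \<omega> T \<in> U} | \<omega> U. \<omega> \<in> predual_functionals (carrier G) \<and> open U}"
    by (intro CollectI exI[of _ "\<lambda>T. \<Sum>i. l2_inner (carrier G) (T (\<lambda>_. 0)) (\<lambda>_. 0)"] exI[of _ UNIV]) simp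
  then show ?thesis
    unfolding weak_star_def topology_generated_by_topspace by blast
qed

lemma continuous_map_cmult:
  fixes f :: "'b \<Rightarrow> complex"
  assumes "continuous_map X euclidean f"
  shows "continuous_map X euclidean (\<lambda>x. c * f x)"
proof -
  have "continuous_map euclidean euclidean ((*) c)"
    by (auto intro!: continuous_intros)
  from continuous_map_compose[OF assms this] show ?thesis
    by (simp add: o_def)
qed

context
  fixes G :: "('a, 'm) monoid_scheme"
  assumes group: "group G"
begin

interpretation group G by (rule group)

lemma left_regular_one:
  "left_regular G \<one>\<^bsub>G\<^esub> = (\<lambda>f. if f \<in> l2 (carrier G) then f else (\<lambda>_. 0))"
  by (auto simp: left_regular_def l2_def fun_eq_iff)

text \<open>The identity operator commutes with every bounded operator, hence belongs to every
  commutant, in particular to the double one.\<close>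

lemma left_regular_one_in_VN: "left_regular G \<one>\<^bsub>G\<^esub> \<in> VN G"
proof -
  let ?X = "carrier G"
  have lin: "(\<lambda>x. a * f x + b * g x) \<in> l2 ?X" if "f \<in> l2 ?X" "g \<in> l2 ?X" for a b f g
  proof -
    have scaled: "(\<lambda>x. c * h x) \<in> l2 ?X" if "h \<in> l2 ?X" for c h
      using that by (auto simp: l2_def norm_mult power_mult_distrib intro: summable_on_cmult_right)
    \<comment> \<open>Closure under addition is read off from \<open>l2_sum\<close> with two
      summands.\<close>
    have "(\<lambda>x. \<Sum>j<2. (if j = (0::nat) then \<lambda>x. a * f x else (\<lambda>x. b * g x)) x) \<in> l2 ?X"
      using that scaled by (intro l2_sum(1)) auto
    then show ?thesis
      by (simp add: numeral_2_eq_2)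
  qed
  have "left_regular G \<one>\<^bsub>G\<^esub> \<in> bounded_ops ?X"
    unfolding bounded_ops_def left_regular_one
    by (auto simp: lin intro!: exI[of _ 1])
  moreover have "left_regular G \<one>\<^bsub>G\<^esub> \<circ> R = R \<circ> left_regular G \<one>\<^bsub>G\<^esub>"
    if R: "R \<in> bounded_ops ?X" for R
  proof
    fix f
    \<comment> \<open>For arguments outside \<open>l2\<close> the normalised identity returns zero,
      so commutation there needs that \<open>R\<close> fixes zero.\<close>
    have "R (\<lambda>_. 0) = (\<lambda>_. 0)"
    proof -
      have "\<forall>f\<in>l2 ?X. \<forall>g\<in>l2 ?X. \<forall>a b.
          R (\<lambda>x. a * f x + b * g x) = (\<lambda>x. a * R f x + b * R g x)"
        using R by (simp add: bounded_ops_def)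
      from this[rule_format, OF l2_zero l2_zero, of 0 0] show ?thesis by simp
    qed
    then show "(left_regular G \<one>\<^bsub>G\<^esub> \<circ> R) f = (R \<circ> left_regular G \<one>\<^bsub>G\<^esub>) f"
      using R by (auto simp: left_regular_one bounded_ops_def)
  qed
  ultimately show ?thesis
    unfolding VN_def commutant_def by blast
qed

section \<open>The completely bounded norm dominates the value at the unit\<close>

lemma op_matrix_norm_left_regular_one:
  "op_matrix_norm (carrier G) 1 (\<lambda>_ _. left_regular G \<one>\<^bsub>G\<^esub>) \<le> 1"
  unfolding op_matrix_norm_def
proof (rule cSup_least)
  have "L2_set (\<lambda>j. l2_norm (carrier G) (\<lambda>_. 0)) {..<1::nat} \<le> 1"
    by (simp add: L2_set_def l2_norm_zero)
  then show "{L2_set (\<lambda>i. l2_norm (carrier G) (\<lambda>x. \<Sum>j<1::nat. left_regular G \<one>\<^bsub>G\<^esub> (\<xi> j) x)) {..<1::nat} |\<xi>.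
      (\<forall>j<1. \<xi> j \<in> l2 (carrier G)) \<and> L2_set (\<lambda>j. l2_norm (carrier G) (\<xi> j)) {..<1::nat} \<le> 1} \<noteq> {}"
    using l2_zero[of "carrier G"] by (auto intro!: exI[of _ "\<lambda>_ _. 0"])
qed (auto simp: left_regular_one L2_set_def)

text \<open>Besides giving a lower bound for \<open>cb_norm\<close>, this shows that the set
  defining it is nonempty.\<close>

lemma unit_in_amplification_norms:
  "complex_matrix_norm 1 (amplification n \<Phi> 1 (\<lambda>_ _ _. left_regular G \<one>\<^bsub>G\<^esub>)) \<in> amplification_norms n G \<Phi>"
  unfolding amplification_norms_def
  using left_regular_one_in_VN op_matrix_norm_left_regular_one
  by (intro CollectI exI[of _ 1] exI[of _ "\<lambda>_ _ _. left_regular G \<one>\<^bsub>G\<^esub>"]) simp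

text \<open>For \<open>k = 1\<close> there is just one index path, the constant zero path, so the
  amplification at the identity operators is the scalar \<Phi>(I, ..., I); testing it on the vector
  1 gives its modulus.\<close>

lemma cmod_le_cb_norm:
  assumes "completely_bounded n G \<Phi>"
  shows "cmod (\<Phi> (replicate n (left_regular G \<one>\<^bsub>G\<^esub>))) \<le> cb_norm n G \<Phi>"
proof -
  define A :: "nat \<Rightarrow> nat \<Rightarrow> nat \<Rightarrow> 'a operator" where "A = (\<lambda>_ _ _. left_regular G \<one>\<^bsub>G\<^esub>)"
  have "p = replicate (Suc n) 0" if p: "p \<in> tuples (Suc n) {..<1}" for p :: "nat list"
  proof (rule nth_equalityI)
    show "length p = length (replicate (Suc n) (0 :: nat))"
      using p by (simp add: tuples_def)
    show "p ! i = replicate (Suc n) 0 ! i" if "i < length p" for i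
      using tuples_nth[OF p, of i] that p by (simp add: tuples_def del: replicate.simps)
  qed
  moreover have "replicate (Suc n) (0 :: nat) \<in> tuples (Suc n) {..<1}"
    by (auto simp: tuples_def)
  moreover have "replicate (Suc n) (0 :: nat) ! 0 = 0" "replicate (Suc n) (0 :: nat) ! n = 0"
    by (simp_all del: replicate.simps)
  ultimately have paths:
    "{p \<in> tuples (Suc n) {..<1}. p ! 0 = 0 \<and> p ! n = 0} = {replicate (Suc n) (0 :: nat)}"
    by blast
  have amp: "amplification n \<Phi> 1 A 0 0 = \<Phi> (replicate n (left_regular G \<one>\<^bsub>G\<^esub>))"
    unfolding amplification_def paths by (simp add: A_def map_replicate_const)
  have "cmod (\<Phi> (replicate n (left_regular G \<one>\<^bsub>G\<^esub>)))
      = L2_set (\<lambda>i. cmod (\<Sum>j<1. amplification n \<Phi> 1 A i j * 1)) {..<1}"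
    by (simp add: L2_set_def flip: amp)
  also have "\<dots> \<le> complex_matrix_norm 1 (amplification n \<Phi> 1 A)"
    by (intro complex_matrix_norm_upper) (simp add: L2_set_def)
  also have "\<dots> \<le> cb_norm n G \<Phi>"
    unfolding cb_norm_def
  proof (rule cSup_upper)
    show "complex_matrix_norm 1 (amplification n \<Phi> 1 A) \<in> amplification_norms n G \<Phi>"
      unfolding A_def by (rule unit_in_amplification_norms)
    show "bdd_above (amplification_norms n G \<Phi>)"
      using assms by (simp add: completely_bounded_def)
  qed
  finally show ?thesis .
qed


subsection \<open>The space \<open>A\<^sup>n(G)\<close>\<close>

text \<open>For complete boundedness, the amplification is linear in the functional, so uniform
  bounds \<open>C\<close> and \<open>D\<close> combine by the triangle inequality for matrix
  norms.\<close>

lemma normal_cb_functionals_lincomb: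
  assumes "\<Phi> \<in> normal_cb_functionals n G" "\<Psi> \<in> normal_cb_functionals n G"
  shows "(\<lambda>Ts. a * \<Phi> Ts + b * \<Psi> Ts) \<in> normal_cb_functionals n G"
proof -
  have "multilinear_on_VN n G (\<lambda>Ts. a * \<Phi> Ts + b * \<Psi> Ts)"
    using assms unfolding normal_cb_functionals_def multilinear_on_VN_def
    by (simp add: algebra_simps)
  moreover have "separately_normal n G (\<lambda>Ts. a * \<Phi> Ts + b * \<Psi> Ts)"
    using assms unfolding normal_cb_functionals_def separately_normal_def
    by (auto intro!: continuous_map_add continuous_map_cmult)
  moreover have "completely_bounded n G (\<lambda>Ts. a * \<Phi> Ts + b * \<Psi> Ts)"
  proof -
    obtain C D where C: "\<And>x. x \<in> amplification_norms n G \<Phi> \<Longrightarrow> x \<le> C"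
      and D: "\<And>x. x \<in> amplification_norms n G \<Psi> \<Longrightarrow> x \<le> D"
      using assms unfolding normal_cb_functionals_def completely_bounded_def bdd_above_def by blast
    have amp: "amplification n (\<lambda>Ts. a * \<Phi> Ts + b * \<Psi> Ts) k A
        = (\<lambda>i j. a * amplification n \<Phi> k A i j + b * amplification n \<Psi> k A i j)" for k A
      by (simp add: amplification_def sum.distrib sum_distrib_left fun_eq_iff)
    have "x \<le> cmod a * C + cmod b * D"
      if mem: "x \<in> amplification_norms n G (\<lambda>Ts. a * \<Phi> Ts + b * \<Psi> Ts)" for x
    proof -
      obtain k A where x: "x = complex_matrix_norm k (amplification n (\<lambda>Ts. a * \<Phi> Ts + b * \<Psi> Ts) k A)"
        and A: "1 \<le> k"
          "\<forall>r<n. (\<forall>i<k. \<forall>j<k. A r i j \<in> VN G) \<and> op_matrix_norm (carrier G) k (A r) \<le> 1"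
        using mem unfolding amplification_norms_def by blast
      have "complex_matrix_norm k (amplification n \<Phi> k A) \<le> C"
        by (rule C) (use A in \<open>unfold amplification_norms_def, blast\<close>)
      moreover have "complex_matrix_norm k (amplification n \<Psi> k A) \<le> D"
        by (rule D) (use A in \<open>unfold amplification_norms_def, blast\<close>)
      ultimately show ?thesis
        unfolding x amp
        by (intro order_trans[OF complex_matrix_norm_lincomb] add_mono mult_left_mono) auto
    qed
    then show ?thesis
      unfolding completely_bounded_def by (rule bdd_aboveI)
  qed
  ultimately show ?thesis
    by (simp add: normal_cb_functionals_def)
qed

lemma An_lincomb:
  assumes "u \<in> An n G" "v \<in> An n G"
  shows "(\<lambda>xs. a * u xs + b * v xs) \<in> An n G"
proof -
  obtain \<Phi> \<Psi> where "\<Phi> \<in> normal_cb_functionals n G" "u = coefficient n G \<Phi>"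
    and "\<Psi> \<in> normal_cb_functionals n G" "v = coefficient n G \<Psi>"
    using assms unfolding An_def by blast
  then show ?thesis
    unfolding An_def
    by (intro image_eqI[OF _ normal_cb_functionals_lincomb[of \<Phi> n \<Psi> a b]])
       (auto simp: coefficient_def)
qed

lemma coefficient_one:
  "coefficient n G \<Phi> (replicate n \<one>\<^bsub>G\<^esub>) = \<Phi> (replicate n (left_regular G \<one>\<^bsub>G\<^esub>))"
  by (auto simp: coefficient_def tuples_def)

text \<open>Every functional representing \<open>u\<close> has the value u(e, ..., e) at (I, ...,
  I), so its norm is at least the modulus of that value, and this passes to the infimum.\<close>

lemma cmod_one_le_An_norm:
  assumes "u \<in> An n G"
  shows "cmod (u (replicate n \<one>\<^bsub>G\<^esub>)) \<le> An_norm n G u"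
  unfolding An_norm_def
proof (rule cInf_greatest)
  show "{cb_norm n G \<Phi> |\<Phi>. \<Phi> \<in> normal_cb_functionals n G \<and> u = coefficient n G \<Phi>} \<noteq> {}"
    using assms unfolding An_def by blast
qed (auto simp: coefficient_one normal_cb_functionals_def intro: cmod_le_cb_norm)

lemma An_norm_nonneg: "u \<in> An n G \<Longrightarrow> 0 \<le> An_norm n G u"
  using cmod_one_le_An_norm norm_ge_zero order_trans by blast

lemma An_norm_le:
  assumes "\<Phi> \<in> normal_cb_functionals n G"
  shows "An_norm n G (coefficient n G \<Phi>) \<le> cb_norm n G \<Phi>"
  unfolding An_norm_def
proof (rule cInf_lower)
  \<comment> \<open>An infimum of reals lies below its members only if the set is bounded
    below.\<close>
  have "0 \<le> cb_norm n G \<Psi>" if "\<Psi> \<in> normal_cb_functionals n G" for \<Psi>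
    using order_trans[OF norm_ge_zero cmod_le_cb_norm] that by (simp add: normal_cb_functionals_def)
  then show "bdd_below {cb_norm n G \<Psi> |\<Psi>. \<Psi> \<in> normal_cb_functionals n G \<and>
      coefficient n G \<Phi> = coefficient n G \<Psi>}"
    by (intro bdd_belowI[of _ 0]) auto
qed (use assms in blast)

section \<open>The dual norm\<close>

lemma VNn_norm_upper:
  assumes "T \<in> VNn n G" "u \<in> An n G" "An_norm n G u \<le> 1"
  shows "cmod (T u) \<le> VNn_norm n G T"
  unfolding VNn_norm_def functional_norm_def
proof (rule cSup_upper)
  obtain C where C: "\<And>v. v \<in> An n G \<Longrightarrow> cmod (T v) \<le> C * An_norm n G v"
    using assms(1) by (auto simp: VNn_def bounded_functional_on_def)
  \<comment> \<open>Makes the supremum over the unit ball finite; \<open>C\<close> may be negative,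
    hence the absolute value.\<close>
  have "cmod (T v) \<le> \<bar>C\<bar>" if "v \<in> An n G" "An_norm n G v \<le> 1" for v
  proof -
    have "cmod (T v) \<le> C * An_norm n G v" using C that by blast
    also have "\<dots> \<le> \<bar>C\<bar> * 1"
      using that An_norm_nonneg by (intro mult_mono) auto
    finally show ?thesis by simp
  qed
  then show "bdd_above {cmod (T v) |v. v \<in> An n G \<and> An_norm n G v \<le> 1}"
    by (intro bdd_aboveI[of _ "\<bar>C\<bar>"]) auto
qed (use assms in blast)


subsection \<open>The product of vector states\<close>

text \<open>Pairing with \<delta>_e is evaluation at the identity, so each factor is the canonical
  trace of VN(G).\<close>

definition vector_state_product :: "nat \<Rightarrow> 'a operator list \<Rightarrow> complex" where
  "vector_state_product n Ts = (\<Prod>i<n. (Ts ! i) (point_mass \<one>\<^bsub>G\<^esub>) \<one>\<^bsub>G\<^esub>)"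

text \<open>Isolates one slot: in it the product is a constant times the vector state, which yields
  both multilinearity and separate normality.\<close>

lemma vector_state_product_update:
  assumes "length Ts = n" "i < n"
  shows "vector_state_product n (Ts[i := T]) =
    (\<Prod>j\<in>{..<n} - {i}. (Ts ! j) (point_mass \<one>\<^bsub>G\<^esub>) \<one>\<^bsub>G\<^esub>) * T (point_mass \<one>\<^bsub>G\<^esub>) \<one>\<^bsub>G\<^esub>"
  unfolding vector_state_product_def
  using assms by (subst prod.remove[of _ i]) (auto intro!: prod.cong)

lemma continuous_map_vector_state:
  "continuous_map (weak_star G) euclidean (\<lambda>T. T (point_mass \<one>\<^bsub>G\<^esub>) \<one>\<^bsub>G\<^esub>)"
proof -
  let ?X = "carrier G"
  \<comment> \<open>Predual functionals are given by sequences of vectors, so \<delta>_e is padded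
    with zeros.\<close>
  define \<xi> :: "nat \<Rightarrow> 'a \<Rightarrow> complex"
    where "\<xi> = (\<lambda>i. if i = 0 then point_mass \<one>\<^bsub>G\<^esub> else (\<lambda>_. 0))"
  have "summable (\<lambda>i. (l2_norm ?X (\<xi> i))\<^sup>2)"
    by (rule summable_finite[of "{0}"]) (auto simp: \<xi>_def l2_norm_zero)
  moreover have "\<xi> i \<in> l2 ?X" for i
    by (simp add: \<xi>_def l2_zero point_mass_in_l2)
  moreover have "(\<lambda>T. T (point_mass \<one>\<^bsub>G\<^esub>) \<one>\<^bsub>G\<^esub>) = (\<lambda>T. \<Sum>i. l2_inner ?X (T (\<xi> i)) (\<xi> i))"
  proof
    fix T :: "'a operator"
    have "(\<Sum>i. l2_inner ?X (T (\<xi> i)) (\<xi> i)) = (\<Sum>i\<in>{0}. l2_inner ?X (T (\<xi> i)) (\<xi> i))"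
      by (intro suminf_finite) (auto simp: \<xi>_def l2_inner_def)
    then show "T (point_mass \<one>\<^bsub>G\<^esub>) \<one>\<^bsub>G\<^esub> = (\<Sum>i. l2_inner ?X (T (\<xi> i)) (\<xi> i))"
      by (simp add: \<xi>_def l2_inner_point_mass)
  qed
  ultimately have pre: "(\<lambda>T. T (point_mass \<one>\<^bsub>G\<^esub>) \<one>\<^bsub>G\<^esub>) \<in> predual_functionals ?X"
    unfolding predual_functionals_def by (intro CollectI exI[of _ \<xi>] conjI allI)
  have "openin (weak_star G) {T \<in> VN G. T (point_mass \<one>\<^bsub>G\<^esub>) \<one>\<^bsub>G\<^esub> \<in> U}" if "open U" for U
    unfolding weak_star_def
    by (intro topology_generated_by_Basis CollectI conjI refl pre that
        exI[of _ "\<lambda>T. T (point_mass \<one>\<^bsub>G\<^esub>) \<one>\<^bsub>G\<^esub>"] exI[of _ U])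
  then show ?thesis
    by (simp add: continuous_map_def topspace_weak_star)
qed

text \<open>The scalar matrix is the compression V* A V of \<open>A\<close>, where V sends
  \<open>z\<close> to the family \<open>z j\<close> times \<delta>_e. V is isometric and taking the
  coordinate at the identity is contractive, so the norm does not grow.\<close>

lemma vector_state_contractive:
  assumes A: "\<And>i j. i < k \<Longrightarrow> j < k \<Longrightarrow> A i j \<in> VN G" "op_matrix_norm (carrier G) k A \<le> 1"
    and z: "L2_set (\<lambda>j. cmod (z j)) {..<k} \<le> 1"
  shows "L2_set (\<lambda>i. cmod (\<Sum>j<k. A i j (point_mass \<one>\<^bsub>G\<^esub>) \<one>\<^bsub>G\<^esub> * z j)) {..<k} \<le> 1"
proof -
  let ?X = "carrier G"
  define \<xi> where "\<xi> = (\<lambda>j x. z j * point_mass \<one>\<^bsub>G\<^esub> x)"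
  have \<xi>: "\<xi> j \<in> l2 ?X" "l2_norm ?X (\<xi> j) = cmod (z j)" for j
    using scaled_point_mass[OF one_closed] by (auto simp: \<xi>_def)
  have ops: "A i j \<in> bounded_ops ?X" if "i < k" "j < k" for i j
    using A(1)[OF that] VN_subset_bounded_ops by blast
  have "cmod (\<Sum>j<k. A i j (point_mass \<one>\<^bsub>G\<^esub>) \<one>\<^bsub>G\<^esub> * z j)
      \<le> l2_norm ?X (\<lambda>x. \<Sum>j<k. A i j (\<xi> j) x)" if i: "i < k" for i
  proof -
    have "A i j (\<xi> j) \<one>\<^bsub>G\<^esub> = A i j (point_mass \<one>\<^bsub>G\<^esub>) \<one>\<^bsub>G\<^esub> * z j" if "j < k" for j
    proof -
      \<comment> \<open>The summand with coefficient zero brings the scaled vector into the two-term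
        form in which \<open>bounded_ops\<close> states linearity.\<close>
      have "A i j (\<lambda>x. z j * point_mass \<one>\<^bsub>G\<^esub> x + 0 * point_mass \<one>\<^bsub>G\<^esub> x)
        = (\<lambda>x. z j * A i j (point_mass \<one>\<^bsub>G\<^esub>) x + 0 * A i j (point_mass \<one>\<^bsub>G\<^esub>) x)"
        using ops[OF i that] point_mass_in_l2[OF one_closed] unfolding bounded_ops_def by blast
      then show ?thesis
        by (simp add: \<xi>_def)
    qed
    moreover have "(\<lambda>x. \<Sum>j<k. A i j (\<xi> j) x) \<in> l2 ?X"
      using ops[OF i] \<xi>(1) by (intro l2_sum(1)) (auto simp: bounded_ops_def)
    ultimately show ?thesis
      using cmod_le_l2_norm[OF _ one_closed, of "\<lambda>x. \<Sum>j<k. A i j (\<xi> j) x"] by simp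
  qed
  then have "L2_set (\<lambda>i. cmod (\<Sum>j<k. A i j (point_mass \<one>\<^bsub>G\<^esub>) \<one>\<^bsub>G\<^esub> * z j)) {..<k}
      \<le> L2_set (\<lambda>i. l2_norm ?X (\<lambda>x. \<Sum>j<k. A i j (\<xi> j) x)) {..<k}"
    by (intro L2_set_mono) auto
  also have "\<dots> \<le> op_matrix_norm ?X k A"
    using ops \<xi> z by (intro op_matrix_norm_upper) auto
  finally show ?thesis
    using A(2) by simp
qed

text \<open>The functional is a product of one-variable functionals, so its amplification is the
  product of the scalar matrices \<open>M r\<close>, each contractive by
  \<open>vector_state_contractive\<close>.\<close>

lemma amplification_norms_vector_state_product:
  assumes "x \<in> amplification_norms n G (vector_state_product n)"
  shows "x \<le> 1"
proof -
  obtain k A where x: "x = complex_matrix_norm k (amplification n (vector_state_product n) k A)"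
    and A: "\<And>r i j. r < n \<Longrightarrow> i < k \<Longrightarrow> j < k \<Longrightarrow> A r i j \<in> VN G"
      "\<And>r. r < n \<Longrightarrow> op_matrix_norm (carrier G) k (A r) \<le> 1"
    using assms unfolding amplification_norms_def by blast
  define M where "M = (\<lambda>r i j. A r i j (point_mass \<one>\<^bsub>G\<^esub>) \<one>\<^bsub>G\<^esub>)"
  have amp: "(\<Sum>j<k. amplification n (vector_state_product n) k A i j * z j)
      = (\<Sum>p\<in>{p \<in> tuples (Suc n) {..<k}. p ! 0 = i}.
          (\<Prod>r<n. M r (p ! r) (p ! Suc r)) * z (p ! n))" for i z
  proof -
    let ?P = "{p \<in> tuples (Suc n) {..<k}. p ! 0 = i}"
    have "p ! n < k" if "p \<in> ?P" for p
      using tuples_nth[of p "Suc n" "{..<k}" n] that by simp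
    \<comment> \<open>Paths from \<open>i\<close> with free endpoint are grouped by that endpoint,
      which is the summation index of the matrix-vector product.\<close>
    then have "(\<Sum>p\<in>?P. (\<Prod>r<n. M r (p ! r) (p ! Suc r)) * z (p ! n))
        = (\<Sum>j<k. \<Sum>p\<in>{p \<in> ?P. p ! n = j}. (\<Prod>r<n. M r (p ! r) (p ! Suc r)) * z (p ! n))"
      by (intro sum.group[symmetric]) (auto intro: finite_subset[OF _ finite_tuples])
    also have "\<dots> = (\<Sum>j<k. amplification n (vector_state_product n) k A i j * z j)"
      unfolding amplification_def sum_distrib_right
      by (intro sum.cong) (auto simp: vector_state_product_def M_def)
    finally show ?thesis ..
  qed
  show ?thesis
    unfolding x
  proof (rule complex_matrix_norm_least)
    fix z :: "nat \<Rightarrow> complex"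
    assume "L2_set (\<lambda>j. cmod (z j)) {..<k} \<le> 1"
    then show "L2_set (\<lambda>i. cmod (\<Sum>j<k. amplification n (vector_state_product n) k A i j * z j))
        {..<k} \<le> 1"
      unfolding amp M_def by (intro L2_set_paths_le vector_state_contractive A) auto
  qed
qed

lemma vector_state_product_normal_cb: "vector_state_product n \<in> normal_cb_functionals n G"
proof -
  have "multilinear_on_VN n G (vector_state_product n)"
    unfolding multilinear_on_VN_def tuples_def
    by (simp add: vector_state_product_update op_lincomb_def algebra_simps)
  moreover have "separately_normal n G (vector_state_product n)"
    unfolding separately_normal_def tuples_def
    by (auto simp: vector_state_product_update
        intro!: continuous_map_cmult continuous_map_vector_state)
  moreover have "completely_bounded n G (vector_state_product n)"
    unfolding completely_bounded_def
    by (rule bdd_aboveI[of _ 1]) (rule amplification_norms_vector_state_product)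
  ultimately show ?thesis
    by (simp add: normal_cb_functionals_def)
qed

lemma cb_norm_vector_state_product: "cb_norm n G (vector_state_product n) \<le> 1"
  unfolding cb_norm_def
proof (rule cSup_least)
  show "amplification_norms n G (vector_state_product n) \<noteq> {}"
    using unit_in_amplification_norms by blast
qed (rule amplification_norms_vector_state_product)


subsection \<open>The indicator function of the identity\<close>

definition identity_indicator :: "nat \<Rightarrow> 'a list \<Rightarrow> complex" where
  "identity_indicator n = (\<lambda>xs. if xs = replicate n \<one>\<^bsub>G\<^esub> then 1 else 0)"

lemma identity_indicator_one: "identity_indicator n (replicate n \<one>\<^bsub>G\<^esub>) = 1"
  by (simp add: identity_indicator_def)

lemma identity_indicator_eq: "identity_indicator n = coefficient n G (vector_state_product n)"
proof
  fix xs
  \<comment> \<open>Translating \<delta>_e by \<open>x\<close> gives \<delta>_x, whose value at the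
    identity detects \<open>x = e\<close>.\<close>
  have val: "left_regular G x (point_mass \<one>\<^bsub>G\<^esub>) \<one>\<^bsub>G\<^esub> = (if x = \<one>\<^bsub>G\<^esub> then 1 else 0)"
    if "x \<in> carrier G" for x
    using that point_mass_in_l2[OF one_closed] by (auto simp: left_regular_def point_mass_def)
  show "identity_indicator n xs = coefficient n G (vector_state_product n) xs"
  proof (cases "xs \<in> tuples n (carrier G)")
    case True
    then have len: "length xs = n" and mem: "\<And>i. i < n \<Longrightarrow> xs ! i \<in> carrier G"
      by (auto simp: tuples_def)
    have "vector_state_product n (map (left_regular G) xs)
        = (\<Prod>i<n. if xs ! i = \<one>\<^bsub>G\<^esub> then 1 else 0)"
      unfolding vector_state_product_def using len mem val by (intro prod.cong) auto
    also have "\<dots> = (if xs = replicate n \<one>\<^bsub>G\<^esub> then 1 else 0)"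
      using len by (auto simp: list_eq_iff_nth_eq prod_zero_iff)
    finally show ?thesis
      using True by (simp add: identity_indicator_def coefficient_def)
  next
    case False
    then show ?thesis
      by (auto simp: identity_indicator_def coefficient_def tuples_def)
  qed
qed

lemma identity_indicator_in_An: "identity_indicator n \<in> An n G"
  unfolding identity_indicator_eq An_def using vector_state_product_normal_cb by blast

lemma An_norm_identity_indicator: "An_norm n G (identity_indicator n) \<le> 1"
  unfolding identity_indicator_eq
  using An_norm_le[OF vector_state_product_normal_cb] cb_norm_vector_state_product by (rule order_trans)

text \<open>Multiplication by the indicator erases all values of \<open>u\<close> but the one at (e,
  ..., e). Both the invariance of evaluation at the indicator and the formula for its action on
  \<open>T\<close> rest on this.\<close>

lemma VNn_mult_identity_indicator:
  assumes "T \<in> VNn n G"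
  shows "T (\<lambda>xs. u xs * identity_indicator n xs)
      = u (replicate n \<one>\<^bsub>G\<^esub>) * T (identity_indicator n)"
proof -
  have "(\<lambda>xs. u xs * identity_indicator n xs)
    = (\<lambda>xs. u (replicate n \<one>\<^bsub>G\<^esub>) * identity_indicator n xs + 0 * identity_indicator n xs)"
    by (auto simp: identity_indicator_def)
  moreover have "T (\<lambda>xs. a * identity_indicator n xs + 0 * identity_indicator n xs)
      = a * T (identity_indicator n) + 0 * T (identity_indicator n)" for a
    using assms
    by (intro linear_functional_onD[OF _ identity_indicator_in_An identity_indicator_in_An])
       (simp add: VNn_def bounded_functional_on_def)
  ultimately show ?thesis
    by simp
qed


subsection \<open>Invariant means\<close>

text \<open>Evaluation at (e, ..., e) is bounded with constant 1 by
  \<open>cmod_one_le_An_norm\<close>.\<close>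

lemma unit_tensor_in_VNn: "unit_tensor n G \<in> VNn n G"
proof -
  have "linear_functional_on (An n G) (unit_tensor n G)"
    by (simp add: linear_functional_on_def unit_tensor_def An_lincomb)
  moreover have "\<forall>v\<in>An n G. cmod (unit_tensor n G v) \<le> 1 * An_norm n G v"
    by (simp add: unit_tensor_def cmod_one_le_An_norm)
  ultimately show ?thesis
    unfolding VNn_def bounded_functional_on_def
    by (intro CollectI conjI exI[of _ 1]) (simp_all add: unit_tensor_def)
qed

lemma VNn_norm_unit_tensor: "VNn_norm n G (unit_tensor n G) \<le> 1"
  unfolding VNn_norm_def functional_norm_def
proof (rule cSup_least)
  show "{cmod (unit_tensor n G u) |u. u \<in> An n G \<and> An_norm n G u \<le> 1} \<noteq> {}"
    using identity_indicator_in_An An_norm_identity_indicator by blast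
qed (auto simp: unit_tensor_def intro: order_trans[OF cmod_one_le_An_norm])

lemma unit_tensor_identity_indicator: "unit_tensor n G (identity_indicator n) = 1"
  by (simp add: unit_tensor_def identity_indicator_in_An identity_indicator_one)

section \<open>Existence of the invariant mean\<close>

lemma invariant_mean_identity_indicator: "invariant_mean n G (\<lambda>T. T (identity_indicator n))"
proof -
  let ?m = "\<lambda>T. T (identity_indicator n)"
  have bound: "cmod (?m T) \<le> VNn_norm n G T" if "T \<in> VNn n G" for T
    using VNn_norm_upper[OF that identity_indicator_in_An An_norm_identity_indicator] .
  \<comment> \<open>The indicator has norm at most one, so evaluation at it is contractive; the
    value 1 is attained at the unit tensor.\<close>
  have "functional_norm (VNn n G) (VNn_norm n G) ?m = 1"
    unfolding functional_norm_def
  proof (rule cSup_eq_maximum)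
    show "1 \<in> {cmod (?m T) |T. T \<in> VNn n G \<and> VNn_norm n G T \<le> 1}"
      using unit_tensor_in_VNn VNn_norm_unit_tensor
      by (intro CollectI exI[of _ "unit_tensor n G"]) (simp add: unit_tensor_identity_indicator)
  qed (use bound in force)
  moreover have "bounded_functional_on (VNn n G) (VNn_norm n G) ?m"
    unfolding bounded_functional_on_def linear_functional_on_def
    using bound by (auto intro!: exI[of _ 1])
  ultimately show ?thesis
    unfolding invariant_mean_def mean_on_VNn_def
    by (simp add: unit_tensor_identity_indicator An_action_def identity_indicator_in_An
        VNn_mult_identity_indicator)
qed

section \<open>Uniqueness of the invariant mean\<close>

lemma An_action_identity_indicator:
  assumes "T \<in> VNn n G"
  shows "An_action n G (identity_indicator n) T
    = (\<lambda>v. T (identity_indicator n) * unit_tensor n G v)"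
  using VNn_mult_identity_indicator[OF assms]
  by (auto simp: An_action_def unit_tensor_def mult.commute)

lemma invariant_mean_unique:
  assumes m: "invariant_mean n G m" and T: "T \<in> VNn n G"
  shows "m T = T (identity_indicator n)"
proof -
  \<comment> \<open>Invariance is applied with the indicator as \<open>u\<close>, its value at (e,
    ..., e) being 1.\<close>
  have "m T = m (An_action n G (identity_indicator n) T)"
    using m T identity_indicator_in_An
    by (simp add: invariant_mean_def identity_indicator_one)
  also have "\<dots> = m (\<lambda>v. T (identity_indicator n) * unit_tensor n G v + 0 * unit_tensor n G v)"
    by (simp add: An_action_identity_indicator[OF T])
  also have "\<dots> = T (identity_indicator n) * m (unit_tensor n G) + 0 * m (unit_tensor n G)"
    using m by (intro linear_functional_onD[OF _ unit_tensor_in_VNn unit_tensor_in_VNn])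
      (simp add: invariant_mean_def mean_on_VNn_def bounded_functional_on_def)
  finally show ?thesis
    using m by (simp add: invariant_mean_def mean_on_VNn_def)
qed

end

text \<open>Functionals on \<open>VNn n G\<close> are total functions of which only the restriction
  matters, so uniqueness means agreement on \<open>VNn n G\<close>.\<close>

theorem corollary5p8:
  fixes G :: "('a, 'm) monoid_scheme" and n :: nat
  assumes "group G" and "n \<ge> 1"
  shows "\<exists>m. invariant_mean n G m \<and>
           (\<forall>m'. invariant_mean n G m' \<longrightarrow> (\<forall>T \<in> VNn n G. m' T = m T))"
  using invariant_mean_identity_indicator[OF assms(1)] invariant_mean_unique[OF assms(1)] by blast

end
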